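(* For every integer $k \geq 0$ and every real number $x$, the Bernoulli polynomial $B_k(x)$ satisfies $$B_k(x) = \sum_{j=0}^{k} (-1)^{k-j}\, j!\, \left\{ {k \atop j} \right\} \mathcal{H}_{j}(x),$$ where $\mathcal{H}_0(x) = 1$, $\mathcal{H}_1(x) = x - \frac12$, and $$\mathcal{H}_{j}(x) = \frac{1}{j} \left( x - \frac{1}{j+1} \right) + \sum_{t=1}^{j-1} \binom{x+j-t-1}{j+1-t} \frac{1}{t}, \quad j \geq 2.$$
   Context: The Bernoulli polynomials $B_k(x)$ are the standard ones, defined by $\frac{t e^{xt}}{e^t-1} = \sum_{k\ge 0} B_k(x)\frac{t^k}{k!}$. $\left\{ {k \atop j} \right\}$ denotes the Stirling number of the second kind (the number of partitions of a $k$-element set into $j$ nonempty blocks, with $\left\{ {0 \atop 0} \right\} = 1$ and $\left\{ {k \atop 0} \right\} = 0$ for $k \geq 1$). For real $y$ and an integer $p \geq 0$, $\binom{y}{p} = \frac{y(y-1)\cdots(y-p+1)}{p!}$. The polynomials $\mathcal{H}_j(x)$ are called hyperharmonic polynomials: $\mathcal{H}_j(x) := H_{j+1}^{(x-1)}$ is the polynomial extension in the order of the hyperharmonic numbers, which are defined by $H_n^{(0)} = \frac1n$ for $n\ge 1$ and $H_n^{(r)} = \sum_{k=1}^n H_k^{(r-1)}$, and which satisfy $H_j^{(n)} = \sum_{t=1}^{j} \binom{n+j-t-1}{j-t}\frac1t$ for $n, j \geq 1$. *)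

theory Defs
  imports
    Complex_Main
    "HOL-Computational_Algebra.Formal_Power_Series"
    "HOL-Computational_Algebra.Polynomial"
    "HOL-Combinatorics.Stirling"
begin

definition bernpoly :: "nat \<Rightarrow> real \<Rightarrow> real" where
  "bernpoly k x = fact k * fps_nth (fps_X * fps_exp x / (fps_exp 1 - 1)) k"

(* Both factors in the quotient have subdegree at least 1, so the division of formal power
   series is exact: the defining generating function identity holds in product form. *)
lemma bernpoly_generating_function:
  "(fps_exp 1 - 1) * Abs_fps (\<lambda>k. bernpoly k x / fact k) = fps_X * fps_exp x"
proof -
  have nz: "fps_exp 1 - 1 \<noteq> (0 :: real fps)"
  proof
    assume "fps_exp 1 - 1 = (0 :: real fps)"
    then have "fps_nth (fps_exp 1 - 1 :: real fps) 1 = 0" by simp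
    then show False by simp
  qed
  have sub: "subdegree (fps_exp 1 - 1 :: real fps) = 1"
    by (rule subdegreeI) auto
  have "subdegree (fps_X * fps_exp x :: real fps) \<ge> 1"
    by (rule subdegree_geI) (auto simp: fps_eq_iff intro!: exI[of _ 1])
  then have "(fps_exp 1 - 1) dvd (fps_X * fps_exp x :: real fps)"
    using sub nz by (simp add: fps_dvd_iff)
  moreover have "Abs_fps (\<lambda>k. bernpoly k x / fact k) = fps_X * fps_exp x / (fps_exp 1 - 1)"
    by (simp add: bernpoly_def fps_eq_iff)
  ultimately show ?thesis by simp
qed

(* hyperharmonic r n is H_n^(r), for n \<ge> 1; the value at n = 0 is irrelevant. *)
fun hyperharmonic :: "nat \<Rightarrow> nat \<Rightarrow> real" where
  "hyperharmonic 0 n = 1 / real n"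
| "hyperharmonic (Suc r) n = (\<Sum>k=1..n. hyperharmonic r k)"

lemma hyperharmonic_gbinomial:
  "hyperharmonic r n = (\<Sum>t=1..n. ((real r + real (n - t) - 1) gchoose (n - t)) / real t)"
proof (induction r arbitrary: n)
  case 0
  have *: "((real m - 1) gchoose m) = (if m = 0 then 1 else 0)" for m
  proof (cases m)
    case (Suc m')
    have "((real m' :: real) gchoose Suc m') = of_nat (m' choose Suc m')"
      by (simp add: binomial_gbinomial)
    then show ?thesis using Suc by simp
  qed simp
  have "(\<Sum>t=1..n. ((real 0 + real (n - t) - 1) gchoose (n - t)) / real t)
      = (\<Sum>t=1..n. if t = n then 1 / real n else 0)"
    by (rule sum.cong) (auto simp: * simp del: of_nat_diff)
  also have "\<dots> = 1 / real n" by (cases "n = 0") (auto simp: sum.delta)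
  finally show ?case by simp
next
  case (Suc r)
  let ?f = "\<lambda>k t. ((real r + real (k - t) - 1) gchoose (k - t)) / real t"
  have "hyperharmonic (Suc r) n = (\<Sum>k=1..n. \<Sum>t=1..k. ?f k t)"
    by (simp add: Suc)
  also have "\<dots> = (\<Sum>k=1..n. \<Sum>t=1..n. if t \<le> k then ?f k t else 0)"
    by (intro sum.cong refl sum.mono_neutral_cong_left) auto
  also have "\<dots> = (\<Sum>t=1..n. \<Sum>k=1..n. if t \<le> k then ?f k t else 0)"
    by (rule sum.swap)
  also have "\<dots> = (\<Sum>t=1..n. ((real (Suc r) + real (n - t) - 1) gchoose (n - t)) / real t)"
  proof (rule sum.cong[OF refl])
    fix t assume t: "t \<in> {1..n}"
    have "(\<Sum>k=1..n. if t \<le> k then ?f k t else 0) = (\<Sum>k=t..n. ?f k t)"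
      using t by (intro sum.mono_neutral_cong_right) auto
    also have "\<dots> = (\<Sum>m\<le>n-t. ((real r - 1 + real m) gchoose m) / real t)"
      using t by (intro sum.reindex_bij_witness[of _ "\<lambda>m. m + t" "\<lambda>k. k - t"])
        (auto simp: algebra_simps)
    also have "\<dots> = (\<Sum>m\<le>n-t. (real r - 1 + of_nat m) gchoose m) / real t"
      by (simp add: sum_divide_distrib)
    also have "\<dots> = ((real r - 1 + of_nat (n - t) + 1) gchoose (n - t)) / real t"
      by (subst gbinomial_parallel_sum) simp
    finally show "(\<Sum>k=1..n. if t \<le> k then ?f k t else 0)
        = ((real (Suc r) + real (n - t) - 1) gchoose (n - t)) / real t"
      by (simp add: algebra_simps)
  qed
  finally show ?case .
qed

lemma hyperharmonic_polynomial_in_order: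
  "\<exists>!p :: real poly. \<forall>r. poly p (real r) = hyperharmonic r n"
proof (rule ex_ex1I)
  define q :: "nat \<Rightarrow> real poly" where
    "q m = smult (1 / fact m) (\<Prod>i=0..<m. [: real m - 1 - real i, 1 :])" for m
  have q: "poly (q m) y = (y + real m - 1) gchoose m" for m y
    by (simp add: q_def gbinomial_prod_rev poly_prod algebra_simps)
  show "\<exists>p :: real poly. \<forall>r. poly p (real r) = hyperharmonic r n"
    by (rule exI[of _ "\<Sum>t=1..n. smult (1 / real t) (q (n - t))"])
      (simp add: hyperharmonic_gbinomial poly_sum q)
next
  fix p q :: "real poly"
  assume p: "\<forall>r. poly p (real r) = hyperharmonic r n"
    and q: "\<forall>r. poly q (real r) = hyperharmonic r n"
  have "range real \<subseteq> {x. poly (p - q) x = 0}" using p q by auto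
  moreover have "infinite (range real)" by (simp add: finite_image_iff inj_on_def)
  ultimately have "infinite {x. poly (p - q) x = 0}" using finite_subset by blast
  then show "p = q" using poly_roots_finite[of "p - q"] by auto
qed

definition hyperharmonic_order_poly :: "nat \<Rightarrow> real poly" where
  "hyperharmonic_order_poly n = (THE p. \<forall>r. poly p (real r) = hyperharmonic r n)"

definition hyperharmonic_poly :: "nat \<Rightarrow> real \<Rightarrow> real" where
  "hyperharmonic_poly j x = poly (hyperharmonic_order_poly (j + 1)) (x - 1)"

end

theory Submission
  imports Defs
begin

text \<open>
  The identity is a change of variable in generating functions. In the order variable,
  hyperharmonic numbers have the generating function
  \<open>\<Sum>\<^sub>n H\<^sub>n\<^sup>(\<^sup>r\<^sup>) z\<^sup>n = - ln (1 - z) (1 - z) powr (- r)\<close>, and since both sides have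
  polynomial coefficients in \<open>r\<close> this makes sense for real order. Hence, writing \<open>z = - w\<close>,
  \<open>w \<Sum>\<^sub>j (-1)\<^sup>j \<H>\<^sub>j(x) w\<^sup>j = ln (1 + w) (1 + w) powr (1 - x)\<close>
  (lemma \<open>hyperharmonic_poly_generating_function\<close>). Substituting \<open>w = exp (- t) - 1\<close> turns the
  logarithm into \<open>- t\<close> and the binomial series into \<open>exp ((x - 1) t)\<close>, so the series becomes
  \<open>t exp (x t) / (exp t - 1)\<close>, the generating function of the Bernoulli polynomials. On the other
  hand, the coefficients of the powers of \<open>exp (- t) - 1\<close> are Stirling numbers of the second kind
  up to sign and factorials (lemma \<open>fps_exp_minus_1_power_nth\<close>), so comparing coefficients of
  \<open>t\<^sup>k\<close> gives the formula. The explicit expressions for \<open>\<H>\<^sub>j\<close> are the convolution formula for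
  hyperharmonic numbers, with the terms \<open>t = j\<close> and \<open>t = j + 1\<close> split off.
\<close>

unbundle fps_syntax

section \<open>Generating function of the hyperharmonic polynomials\<close>

text \<open>
  The right-hand side is a polynomial in \<open>y\<close> that agrees with the hyperharmonic numbers at every
  natural \<open>y\<close>; a polynomial is determined by its values there.
\<close>
lemma poly_hyperharmonic_order_poly:
  "poly (hyperharmonic_order_poly n) y
     = (\<Sum>t=1..n. ((y + real (n - t) - 1) gchoose (n - t)) / real t)"
proof -
  define q :: "nat \<Rightarrow> real poly" where
    "q m = smult (1 / fact m) (\<Prod>i=0..<m. [: real m - 1 - real i, 1 :])" for m
  define p where "p = (\<Sum>t=1..n. smult (1 / real t) (q (n - t)))"
  have q: "poly (q m) y = (y + real m - 1) gchoose m" for m y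
    by (simp add: q_def gbinomial_prod_rev poly_prod algebra_simps)
  have p: "poly p y = (\<Sum>t=1..n. ((y + real (n - t) - 1) gchoose (n - t)) / real t)" for y
    by (simp add: p_def poly_sum q)
  have "hyperharmonic_order_poly n = p"
    unfolding hyperharmonic_order_poly_def
    by (rule the1_equality[OF hyperharmonic_polynomial_in_order])
      (simp add: p hyperharmonic_gbinomial)
  then show ?thesis by (simp add: p)
qed

lemma hyperharmonic_poly_sum:
  "hyperharmonic_poly j x = (\<Sum>t=1..j+1. ((x + real j - real t - 1) gchoose (j + 1 - t)) / real t)"
  unfolding hyperharmonic_poly_def poly_hyperharmonic_order_poly
  by (rule sum.cong) (auto simp: of_nat_diff algebra_simps)

text \<open>
  The series \<open>- fps_ln (- 1)\<close> is \<open>ln (1 + X)\<close>; the parameter \<open>- 1\<close> makes \<open>fps_ln\<close> the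
  compositional inverse of \<open>exp (- X) - 1\<close>. The reflection
  \<open>(- a) gchoose k = (- 1)\<^sup>k ((a + k - 1) gchoose k)\<close> identifies the Cauchy product with the
  convolution formula.
\<close>
lemma hyperharmonic_poly_generating_function:
  "fps_X * Abs_fps (\<lambda>j. (-1) ^ j * hyperharmonic_poly j x)
     = - fps_ln (-1) * fps_binomial (1 - x)"
proof (rule fps_ext)
  fix n
  show "(fps_X * Abs_fps (\<lambda>j. (-1) ^ j * hyperharmonic_poly j x)) $ n
      = (- fps_ln (-1) * fps_binomial (1 - x)) $ n"
  proof (cases n)
    case 0
    then show ?thesis by simp
  next
    case (Suc j)
    have "(- fps_ln (-1) * fps_binomial (1 - x)) $ Suc j
        = (\<Sum>t=0..Suc j. - (fps_ln (-1) $ t) * ((1 - x) gchoose (Suc j - t)))"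
      by (simp add: fps_mult_nth sum_negf)
    also have "\<dots> = (\<Sum>t=1..Suc j. - (fps_ln (-1) $ t) * ((1 - x) gchoose (Suc j - t)))"
      by (simp add: sum.atLeast_Suc_atMost)
    also have "\<dots> = (\<Sum>t=1..j+1. (-1) ^ j * (((x + real j - real t - 1) gchoose (j + 1 - t)) / real t))"
    proof (rule sum.cong)
      fix t assume t: "t \<in> {1..j+1}"
      have "(1 - x) gchoose (Suc j - t) = (- (x - 1)) gchoose (j + 1 - t)" by simp
      also have "\<dots> = (-1) ^ (j + 1 - t) * ((x - 1 + real (j + 1 - t) - 1) gchoose (j + 1 - t))"
        by (rule gbinomial_minus)
      also have "x - 1 + real (j + 1 - t) - 1 = x + real j - real t - 1"
        using t by (simp add: of_nat_diff)
      finally have "- (fps_ln (-1) $ t) * ((1 - x) gchoose (Suc j - t))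
          = ((-1) ^ (t - 1) * (-1) ^ (j + 1 - t)) *
            (((x + real j - real t - 1) gchoose (j + 1 - t)) / real t)"
        using t by (simp add: fps_ln_nth)
      also have "(-1) ^ (t - 1) * (-1) ^ (j + 1 - t) = ((-1) ^ j :: real)"
        using t by (simp flip: power_add)
      finally show "- (fps_ln (-1) $ t) * ((1 - x) gchoose (Suc j - t))
          = (-1) ^ j * (((x + real j - real t - 1) gchoose (j + 1 - t)) / real t)" .
    qed simp
    also have "\<dots> = (-1) ^ j * hyperharmonic_poly j x"
      by (simp only: hyperharmonic_poly_sum sum_distrib_left)
    finally show ?thesis using Suc by simp
  qed
qed

section \<open>Substituting an exponential\<close>

text \<open>
  Formally \<open>(1 + w) powr a\<close> at \<open>1 + w = exp (c X)\<close>: the composition satisfies the differential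
  equation \<open>f' = a c f\<close> with \<open>f(0) = 1\<close>, which characterises \<open>exp (a c X)\<close>.
\<close>
lemma fps_binomial_compose_exp:
  fixes a c :: "'a::field_char_0"
  shows "fps_binomial a oo (fps_exp c - 1) = fps_exp (a * c)"
proof -
  let ?w = "fps_exp c - 1"
  let ?f = "fps_binomial a oo ?w"
  have "fps_deriv (fps_binomial a) oo ?w = (fps_const a * ?f) / (1 + fps_X oo ?w)"
    by (simp add: fps_binomial_deriv fps_divide_compose fps_compose_mult_distrib
        fps_compose_add_distrib)
  also have "\<dots> = (fps_const a * ?f) / fps_exp c"
    by (simp add: fps_compose_add_distrib)
  finally have "fps_deriv ?f = fps_const (a * c) * ?f * (fps_exp c * inverse (fps_exp c))"
    by (simp add: fps_compose_deriv fps_divide_unit mult_ac flip: fps_const_mult)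
  also have "fps_exp c * inverse (fps_exp c) = 1"
    by (rule inverse_mult_eq_1') simp
  finally have "fps_deriv ?f = fps_const (a * c) * ?f" by simp
  then have "?f = fps_const (?f $ 0) * fps_exp (a * c)"
    by (simp only: fps_exp_unique_ODE)
  then show ?thesis by simp
qed

text \<open>
  The exponential generating function of the Stirling numbers of the second kind. Differentiating
  \<open>(exp (c X) - 1)\<^bsup>j+1\<^esup>\<close> gives
  \<open>c (j+1) ((exp (c X) - 1)\<^bsup>j+1\<^esup> + (exp (c X) - 1)\<^bsup>j\<^esup>)\<close>,
  which on coefficients is the recurrence \<open>S(k+1,j+1) = (j+1) S(k,j+1) + S(k,j)\<close>.
\<close>
lemma fps_exp_minus_1_power_nth:
  fixes c :: "'a::field_char_0"
  shows "(fps_exp c - 1) ^ j $ k = c ^ k * fact j * of_nat (Stirling k j) / fact k"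
proof (induction k arbitrary: j)
  case 0
  then show ?case by (cases j) auto
next
  case (Suc k)
  show ?case
  proof (cases j)
    case 0
    then show ?thesis by simp
  next
    case (Suc i)
    let ?E = "fps_exp c - 1"
    have "fps_deriv (?E ^ Suc i) = fps_const (of_nat (Suc i)) * fps_deriv ?E * ?E ^ i"
      by (simp only: fps_deriv_power diff_Suc_1)
    also have "fps_deriv ?E = fps_const c * (?E + 1)"
      by simp
    also have "fps_const (of_nat (Suc i)) * (fps_const c * (?E + 1)) * ?E ^ i
        = fps_const c * fps_const (of_nat (Suc i)) * (?E ^ Suc i + ?E ^ i)"
      by (simp only: power_Suc distrib_left distrib_right mult_1_left mult_ac)
    also have "fps_const c * fps_const (of_nat (Suc i)) = fps_const (c * of_nat (Suc i))"
      by (rule fps_const_mult)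
    finally have "fps_deriv (?E ^ Suc i) $ k
        = c * of_nat (Suc i) * (?E ^ Suc i $ k + ?E ^ i $ k)"
      by (simp only: fps_mult_left_const_nth fps_add_nth)
    then have "of_nat (Suc k) * (?E ^ Suc i $ Suc k)
        = c * of_nat (Suc i) * (?E ^ Suc i $ k + ?E ^ i $ k)"
      by (simp only: fps_deriv_nth Suc_eq_plus1)
    also have "\<dots> = c ^ Suc k * fact (Suc i) * of_nat (Stirling (Suc k) (Suc i)) / fact k"
      unfolding Suc.IH by (simp add: field_simps)
    finally have "?E ^ Suc i $ Suc k
        = c ^ Suc k * fact (Suc i) * of_nat (Stirling (Suc k) (Suc i)) / fact k / of_nat (Suc k)"
      by (metis nonzero_mult_div_cancel_left of_nat_neq_0)
    then show ?thesis using Suc by (simp add: mult_ac)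
  qed
qed

section \<open>The expansion of the Bernoulli polynomials\<close>

text \<open>
  Multiplying the substituted series \<open>(exp (- X) - 1) (G oo (exp (- X) - 1)) = - X exp ((x - 1) X)\<close>
  by \<open>- exp X\<close> gives the equation that defines the Bernoulli generating function, and
  \<open>exp X - 1\<close> can be cancelled.
\<close>
lemma bernpoly_generating_function_compose:
  "Abs_fps (\<lambda>k. bernpoly k x / fact k)
     = Abs_fps (\<lambda>j. (-1) ^ j * hyperharmonic_poly j x) oo (fps_exp (-1) - 1)"
proof -
  let ?G = "Abs_fps (\<lambda>j. (-1) ^ j * hyperharmonic_poly j x)"
  let ?w = "fps_exp (-1) - 1 :: real fps"
  have "fps_ln (-1) oo ?w = fps_X"
    by (simp add: fps_ln_fps_exp_inv fps_inv_fps_exp_compose)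
  moreover have "fps_binomial (1 - x) oo ?w = fps_exp (x - 1)"
    by (simp add: fps_binomial_compose_exp)
  moreover have "?w * (?G oo ?w) = (fps_X * ?G) oo ?w"
    by (simp add: fps_compose_mult_distrib)
  ultimately have "?w * (?G oo ?w) = - fps_X * fps_exp (x - 1)"
    unfolding hyperharmonic_poly_generating_function
    by (simp add: fps_compose_mult_distrib fps_compose_uminus)
  then have "- fps_exp 1 * (?w * (?G oo ?w)) = fps_X * (fps_exp 1 * fps_exp (x - 1))"
    by (simp only: mult_ac minus_mult_left[symmetric] minus_mult_right[symmetric] minus_minus)
  moreover have "- fps_exp 1 * ?w = fps_exp 1 - 1"
    by (simp add: algebra_simps flip: fps_exp_add_mult)
  moreover have "fps_exp 1 * fps_exp (x - 1) = fps_exp x"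
    by (simp flip: fps_exp_add_mult)
  ultimately have "(fps_exp 1 - 1) * (?G oo ?w) = fps_X * fps_exp x"
    by (simp only: mult.assoc[symmetric])
  also have "\<dots> = (fps_exp 1 - 1) * Abs_fps (\<lambda>k. bernpoly k x / fact k)"
    by (rule bernpoly_generating_function[symmetric])
  finally have "(fps_exp 1 - 1) * (?G oo ?w)
      = (fps_exp 1 - 1) * Abs_fps (\<lambda>k. bernpoly k x / fact k)" .
  moreover have "fps_exp 1 - 1 \<noteq> (0 :: real fps)"
    by (auto simp: fps_eq_iff intro!: exI[of _ 1])
  ultimately show ?thesis by simp
qed

lemma bernpoly_eq_sum_Stirling_hyperharmonic_poly:
  "bernpoly k x
     = (\<Sum>j=0..k. (-1) ^ (k - j) * fact j * real (Stirling k j) * hyperharmonic_poly j x)"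
proof -
  have "bernpoly k x / fact k = Abs_fps (\<lambda>k. bernpoly k x / fact k) $ k"
    by simp
  also have "\<dots> = (\<Sum>j=0..k. (-1) ^ j * hyperharmonic_poly j x *
      ((-1) ^ k * fact j * real (Stirling k j) / fact k))"
    unfolding bernpoly_generating_function_compose
    by (simp add: fps_compose_nth fps_exp_minus_1_power_nth)
  finally have "bernpoly k x = fact k * (\<Sum>j=0..k. (-1) ^ j * hyperharmonic_poly j x *
      ((-1) ^ k * fact j * real (Stirling k j) / fact k))"
    by (simp add: field_simps)
  also have "\<dots> = (\<Sum>j=0..k. ((-1) ^ j * (-1) ^ k) * fact j * real (Stirling k j)
      * hyperharmonic_poly j x)"
    by (simp add: sum_distrib_left mult_ac)
  also have "\<dots> = (\<Sum>j=0..k. (-1) ^ (k - j) * fact j * real (Stirling k j)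
      * hyperharmonic_poly j x)"
  proof (rule sum.cong)
    fix j assume "j \<in> {0..k}"
    then obtain d where "k = j + d" by (auto simp: le_iff_add)
    then have "(-1) ^ j * (-1) ^ k = ((-1) ^ (k - j) :: real)"
      by (simp add: power_add mult.assoc[symmetric] power_mult_distrib[symmetric])
    then show "((-1) ^ j * (-1) ^ k) * fact j * real (Stirling k j) * hyperharmonic_poly j x
        = (-1) ^ (k - j) * fact j * real (Stirling k j) * hyperharmonic_poly j x"
      by simp
  qed simp
  finally show ?thesis .
qed

lemma hyperharmonic_poly_split:
  assumes "j \<ge> 1"
  shows "hyperharmonic_poly j x
             = 1 / real j * (x - 1 / (real j + 1))
             + (\<Sum>t=1..j-1. ((x + real j - real t - 1) gchoose (j + 1 - t)) * (1 / real t))"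
proof -
  obtain i where j: "j = Suc i" using assms by (cases j) auto
  let ?f = "\<lambda>t. ((x + real j - real t - 1) gchoose (j + 1 - t)) / real t"
  have "hyperharmonic_poly j x = (\<Sum>t=1..i. ?f t) + ?f (Suc i) + ?f (Suc (Suc i))"
    unfolding hyperharmonic_poly_sum by (simp add: j)
  also have "?f (Suc i) = (x - 1) / real j"
    by (simp add: j)
  also have "?f (Suc (Suc i)) = 1 / (real j + 1)"
    by (simp add: j)
  also have "(\<Sum>t=1..i. ?f t) + (x - 1) / real j + 1 / (real j + 1)
      = ((x - 1) / real j + 1 / (real j + 1)) + (\<Sum>t=1..i. ?f t)"
    by simp
  also have "(x - 1) / real j + 1 / (real j + 1) = 1 / real j * (x - 1 / (real j + 1))"
    using assms by (simp add: field_simps)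
  finally show ?thesis by (simp add: j)
qed

theorem mainTheorem3:
  fixes k :: nat and x :: real
  shows "bernpoly k x
           = (\<Sum>j=0..k. (-1) ^ (k - j) * fact j * real (Stirling k j) * hyperharmonic_poly j x)
       \<and> hyperharmonic_poly 0 x = 1
       \<and> hyperharmonic_poly 1 x = x - 1 / 2
       \<and> (\<forall>j\<ge>2. hyperharmonic_poly j x
             = 1 / real j * (x - 1 / (real j + 1))
             + (\<Sum>t=1..j-1. ((x + real j - real t - 1) gchoose (j + 1 - t)) * (1 / real t)))"
proof (intro conjI allI impI)
  show "hyperharmonic_poly 0 x = 1"
    by (simp add: hyperharmonic_poly_sum)
  show "hyperharmonic_poly 1 x = x - 1 / 2"
    by (simp add: hyperharmonic_poly_split)
qed (use bernpoly_eq_sum_Stirling_hyperharmonic_poly hyperharmonic_poly_split in auto)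

end
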